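(* Let $G$ be a finite simple graph with no isolated vertices, with $n$ vertices, $m$ edges, vertex degrees $d_1,\dots,d_n$, maximum degree $\Delta$, minimum degree $\delta$ and average degree $d=2m/n$. Let $Q_\alpha=\sum_{i\in V(G)}d_i^\alpha$. Then for every $\alpha<0$, \[Q_\alpha\ge n\left(d(\Delta+\delta)-\Delta\delta\right)^{\alpha/2}.\]
   Context: $Q_\alpha$ is the zeroth-order general Randić index, with $d_i$ the degree of vertex $i$. *)

theory Defs imports Complex_Main begin

definition simple_graph :: "'a set \<Rightarrow> 'a set set \<Rightarrow> bool" where
  "simple_graph V E \<longleftrightarrow> finite V \<and> (\<forall>e\<in>E. e \<subseteq> V \<and> card e = 2)"

definition degree :: "'a set set \<Rightarrow> 'a \<Rightarrow> nat" where
  "degree E v = card {e \<in> E. v \<in> e}"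

definition isolated :: "'a set set \<Rightarrow> 'a \<Rightarrow> bool" where
  "isolated E v \<longleftrightarrow> (\<forall>e\<in>E. v \<notin> e)"

definition max_degree :: "'a set \<Rightarrow> 'a set set \<Rightarrow> nat" where
  "max_degree V E = Max (degree E ` V)"

definition min_degree :: "'a set \<Rightarrow> 'a set set \<Rightarrow> nat" where
  "min_degree V E = Min (degree E ` V)"

definition avg_degree :: "'a set \<Rightarrow> 'a set set \<Rightarrow> real" where
  "avg_degree V E = 2 * real (card E) / real (card V)"

text \<open>The zeroth-order general Randic index. Real powers are taken with \<open>powr\<close>, so this is the
  intended sum only for graphs without isolated vertices, as \<open>0 powr \<alpha> = 0\<close>.\<close>

definition zeroth_randic :: "'a set \<Rightarrow> 'a set set \<Rightarrow> real \<Rightarrow> real" where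
  "zeroth_randic V E \<alpha> = (\<Sum>v\<in>V. real (degree E v) powr \<alpha>)"

end

theory Submission imports Defs begin

text \<open>Every degree satisfies \<open>(d\<^sub>i - \<delta>) (\<Delta> - d\<^sub>i) \<ge> 0\<close>; summing and using the handshake lemma, the mean
  of the \<open>d\<^sub>i\<^sup>2\<close> is at most \<open>M = d (\<Delta> + \<delta>) - \<Delta> \<delta>\<close>. The bound follows by summing over all
  vertices the tangent-line inequality at \<open>M\<close> for the convex decreasing function
  \<open>t \<mapsto> t powr (\<alpha> / 2)\<close>, taken at \<open>t = d\<^sub>i\<^sup>2\<close>.\<close>

lemma simple_graph_finite_edges:
  assumes "simple_graph V E"
  shows "finite E"
  using assms by (auto simp: simple_graph_def intro: finite_subset[of E "Pow V"])

text \<open>Double counting of incident pairs: each edge contributes once at each of its two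
  ends.\<close>

lemma handshake:
  assumes "simple_graph V E"
  shows "(\<Sum>v\<in>V. degree E v) = 2 * card E"
  unfolding degree_def
proof (rule sum_multicount)
  show "finite V" "finite E"
    using assms simple_graph_finite_edges by (auto simp: simple_graph_def)
  show "\<forall>e\<in>E. card {v \<in> V. v \<in> e} = 2"
  proof
    fix e assume "e \<in> E"
    then have "e \<subseteq> V" "card e = 2"
      using assms by (auto simp: simple_graph_def)
    moreover from \<open>e \<subseteq> V\<close> have "{v \<in> V. v \<in> e} = e" by auto
    ultimately show "card {v \<in> V. v \<in> e} = 2" by simp
  qed
qed

lemma degree_pos:
  assumes "simple_graph V E" and "\<not> isolated E v"
  shows "degree E v > 0"
  using assms simple_graph_finite_edges[OF assms(1)]
  by (auto simp: degree_def isolated_def card_gt_0_iff)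

text \<open>No derivative is taken: dividing by \<open>M powr p\<close> leaves a claim about x = t /
  M. Since ln x \<le> x - 1 and p \<le> 0, p * (x - 1) \<le> p * ln x, and 1 + y \<le> exp y turns
  the right side into x powr p.\<close>

lemma powr_ge_tangent:
  fixes t M p :: real
  assumes "t > 0" and "M > 0" and "p \<le> 0"
  shows "t powr p \<ge> M powr p * (1 + p * (t / M - 1))"
proof -
  have "1 + p * (t / M - 1) \<le> 1 + p * ln (t / M)"
    using assms ln_le_minus_one[of "t / M"] by (simp add: mult_left_mono_neg)
  also have "\<dots> \<le> exp (p * ln (t / M))"
    by (rule exp_ge_add_one_self)
  also have "\<dots> = (t / M) powr p"
    using assms by (simp add: powr_def)
  finally have "M powr p * (1 + p * (t / M - 1)) \<le> M powr p * (t / M) powr p"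
    by (rule mult_left_mono) simp
  also have "\<dots> = t powr p"
    using assms by (simp add: powr_divide)
  finally show ?thesis .
qed

text \<open>An upper bound on the mean suffices in this form of Jensen's inequality: the tangent at
  \<open>M\<close> has slope of the sign of \<open>p\<close>, so a mean below \<open>M\<close> can
  only raise the sum of the tangent values.\<close>

lemma sum_powr_ge:
  fixes t :: "'a \<Rightarrow> real" and M p :: real
  assumes pos: "\<And>i. i \<in> A \<Longrightarrow> t i > 0" and "M > 0" and "p \<le> 0"
    and mean: "(\<Sum>i\<in>A. t i) \<le> real (card A) * M"
  shows "(\<Sum>i\<in>A. t i powr p) \<ge> real (card A) * M powr p"
proof -
  have "(\<Sum>i\<in>A. t i) / M - real (card A) \<le> 0"
    using mean \<open>M > 0\<close> by (simp add: field_simps)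
  then have "0 \<le> p * ((\<Sum>i\<in>A. t i) / M - real (card A))"
    using \<open>p \<le> 0\<close> by (simp add: mult_nonpos_nonpos)
  then have "M powr p * real (card A)
      \<le> M powr p * (real (card A) + p * ((\<Sum>i\<in>A. t i) / M - real (card A)))"
    by (intro mult_left_mono) auto
  also have "\<dots> = (\<Sum>i\<in>A. M powr p * (1 + p * (t i / M - 1)))"
    by (simp add: sum_distrib_left[symmetric] sum.distrib sum_subtractf sum_divide_distrib)
  also have "\<dots> \<le> (\<Sum>i\<in>A. t i powr p)"
    using pos assms(2,3) by (intro sum_mono powr_ge_tangent)
  finally show ?thesis by (simp add: mult.commute)
qed

lemma sum_degree_squares_le:
  assumes "simple_graph V E" and "V \<noteq> {}"
  shows "(\<Sum>v\<in>V. (real (degree E v))\<^sup>2)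
    \<le> real (card V) * (avg_degree V E * (real (max_degree V E) + real (min_degree V E))
        - real (max_degree V E) * real (min_degree V E))"
    (is "_ \<le> _ * (_ * (?\<Delta> + ?\<delta>) - _)")
proof -
  have fin: "finite V" using assms by (simp add: simple_graph_def)
  have "(real (degree E v))\<^sup>2 \<le> real (degree E v) * (?\<Delta> + ?\<delta>) - ?\<Delta> * ?\<delta>" if "v \<in> V" for v
  proof -
    have "degree E v \<le> max_degree V E" "min_degree V E \<le> degree E v"
      using that fin by (auto simp: max_degree_def min_degree_def)
    \<comment> \<open>Expanding bounds the square by an expression linear in the degree, so after
      summation only the degree sum remains.\<close>
    then have "0 \<le> (real (degree E v) - ?\<delta>) * (?\<Delta> - real (degree E v))"
      by simp
    then show ?thesis by (simp add: algebra_simps power2_eq_square)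
  qed
  then have "(\<Sum>v\<in>V. (real (degree E v))\<^sup>2)
      \<le> (\<Sum>v\<in>V. real (degree E v) * (?\<Delta> + ?\<delta>) - ?\<Delta> * ?\<delta>)"
    by (rule sum_mono)
  also have "\<dots> = real (\<Sum>v\<in>V. degree E v) * (?\<Delta> + ?\<delta>) - real (card V) * (?\<Delta> * ?\<delta>)"
    by (simp add: sum_subtractf sum_distrib_right)
  \<comment> \<open>As \<open>V\<close> is nonempty, \<open>card V\<close> cancels against the
    denominator of \<open>avg_degree\<close>.\<close>
  also have "real (\<Sum>v\<in>V. degree E v) = real (card V) * avg_degree V E"
    using fin assms by (simp add: handshake avg_degree_def)
  finally show ?thesis by (simp add: algebra_simps)
qed

theorem theorem4:
  fixes V :: "'a set" and E :: "'a set set" and \<alpha> d \<Delta> \<delta> :: real and n :: nat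
  assumes "simple_graph V E"
    and "V \<noteq> {}"
    and "\<forall>v\<in>V. \<not> isolated E v"
    and "n = card V"
    and "d = avg_degree V E"
    and "\<Delta> = real (max_degree V E)"
    and "\<delta> = real (min_degree V E)"
    and "\<alpha> < 0"
  shows "zeroth_randic V E \<alpha> \<ge> real n * (d * (\<Delta> + \<delta>) - \<Delta> * \<delta>) powr (\<alpha> / 2)"
proof -
  define M where "M = d * (\<Delta> + \<delta>) - \<Delta> * \<delta>"
  have fin: "finite V" using assms(1) by (simp add: simple_graph_def)
  have pos: "real (degree E v) > 0" if "v \<in> V" for v
    using that assms(1,3) degree_pos by fastforce
  have le: "(\<Sum>v\<in>V. (real (degree E v))\<^sup>2) \<le> real (card V) * M"
    using sum_degree_squares_le[OF assms(1,2)] by (simp add: M_def assms)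
  \<comment> \<open>The sign of \<open>M\<close> is not visible from its formula; it follows because
    \<open>card V * M\<close> dominates a positive sum.\<close>
  have "0 < (\<Sum>v\<in>V. (real (degree E v))\<^sup>2)"
    using fin assms(2) pos by (intro sum_pos) auto
  with le have "0 < real (card V) * M" by linarith
  then have "M > 0" by (simp add: zero_less_mult_iff)
  have "real (card V) * M powr (\<alpha> / 2) \<le> (\<Sum>v\<in>V. (real (degree E v))\<^sup>2 powr (\<alpha> / 2))"
    using pos \<open>M > 0\<close> assms(8) le by (intro sum_powr_ge) auto
  also have "\<dots> = (\<Sum>v\<in>V. real (degree E v) powr \<alpha>)"
  proof (rule sum.cong)
    fix v assume "v \<in> V"
    \<comment> \<open>With the square written as a \<open>powr\<close>, the exponents multiply: 2 *
      (\<alpha> / 2) = \<alpha>.\<close>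
    have "(real (degree E v))\<^sup>2 = real (degree E v) powr 2"
      using pos[OF \<open>v \<in> V\<close>] by simp
    then show "(real (degree E v))\<^sup>2 powr (\<alpha> / 2) = real (degree E v) powr \<alpha>"
      by (simp only: powr_powr) simp
  qed simp
  finally show ?thesis
    by (simp add: zeroth_randic_def M_def assms(4))
qed

end
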